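(* Let $y:[0,\infty)\to\mathbb R$ be a fixed measurable representative of an element of $L^1_{\mathrm{loc}}([0,\infty))$, let $q:[0,\infty)\to[0,\infty)$, and let $K,D',C'>0$ with $K\ne D'$. (All pointwise inequalities below are understood for this fixed representative; no sign assumption on $y$ is required.) Assume that there exists a full-measure set $\mathcal T\subset[0,\infty)$ with $0\in\mathcal T$ such that, for every $s\in\mathcal T$ and every $t\ge s$, $$q(t)\le q(s)e^{-D'(t-s)}$$ and $$y(t)+K\int_s^ty(\tau)\,d\tau\le y(s)+C'q(s)\int_s^te^{-D'(\tau-s)}\,d\tau.$$ Then, for every $s\in\mathcal T$ and every $t\ge s$, $$y(t)\le y(s)e^{-K(t-s)}+\frac{C'q(s)}{K-D'}\left(e^{-D'(t-s)}-e^{-K(t-s)}\right).$$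
   Context: $L^1_{\mathrm{loc}}([0,\infty))$ denotes functions integrable on $[0,T]$ for every finite $T>0$. A full-measure set is one whose complement in $[0,\infty)$ has Lebesgue measure zero. *)

theory Defs
  imports "HOL-Analysis.Analysis"
begin

text \<open>
  A function on the half-line is a total function on the reals whose values at negative
  arguments are never used. An element of the following set is an actual function (not a class
  modulo null sets), i.e. a measurable representative of an element of the quotient space.
\<close>

definition L1_loc :: "(real \<Rightarrow> real) set" where
  "L1_loc = {y. y \<in> borel_measurable (lebesgue_on {0..}) \<and>
                (\<forall>T>0. set_integrable lebesgue {0..T} y)}"

definition full_measure :: "real set \<Rightarrow> bool" where
  "full_measure S \<longleftrightarrow> S \<subseteq> {0..} \<and> {0..} - S \<in> null_sets lebesgue"

end

theory Submission
  imports Defs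
begin

text \<open>
  The quantity \<open>y(t) + K \<integral>\<^sub>s\<^sup>t y - F(t)\<close>, with \<open>F\<close> the integral of the forcing term, is
  nonincreasing along pairs whose earlier point lies in the full-measure set. Fix \<open>t\<close>, let \<open>c\<close> be
  its value at \<open>t\<close>, and let \<open>u\<close> be the explicit solution of \<open>u + K \<integral>\<^sub>s u = c + F\<close>. The primitive
  \<open>Z\<close> of \<open>z = y - u\<close> then satisfies \<open>z + K Z \<ge> 0\<close> almost everywhere on \<open>[s, t]\<close>, which forces
  \<open>Z(t) \<ge> 0\<close>, while \<open>z(t) + K Z(t) = 0\<close> by the choice of \<open>c\<close>. Hence \<open>y(t) \<le> u(t)\<close>, and
  \<open>c \<le> y(s)\<close> gives the claim.
\<close>

lemma integral_nonneg_off_negligible: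
  fixes f :: "real \<Rightarrow> real"
  assumes "negligible N" and "\<And>x. x \<in> S - N \<Longrightarrow> f x \<ge> 0"
  shows "integral S f \<ge> 0"
proof -
  have "integral S f = integral S (\<lambda>x. if x \<in> N then 0 else f x)"
    by (rule integral_spike[OF assms(1)]) auto
  \<comment> \<open>A non-integrable function has integral 0 by convention, so both cases give a
    nonnegative value.\<close>
  also have "\<dots> \<ge> 0"
    using assms(2) by (cases "(\<lambda>x. if x \<in> N then 0 else f x) integrable_on S")
      (auto intro!: integral_nonneg simp: not_integrable_integral)
  finally show ?thesis .
qed

text \<open>If the primitive \<open>Z\<close> were negative at \<open>t\<close>, take the last point
  \<open>a\<close> with \<open>Z a \<ge> 0\<close>. Beyond \<open>a\<close> we have
  \<open>Z < 0\<close>, hence \<open>z \<ge> - K * Z \<ge> 0\<close> almost everywhere, so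
  \<open>Z t \<ge> Z a \<ge> 0\<close>, a contradiction.\<close>

lemma primitive_nonneg_if_supersolution:
  fixes z :: "real \<Rightarrow> real"
  assumes "K \<ge> 0" and "s \<le> t" and int: "z integrable_on {s..t}" and N: "negligible N"
    and super: "\<And>r. r \<in> {s..t} - N \<Longrightarrow> z r + K * integral {s..r} z \<ge> 0"
  shows "integral {s..t} z \<ge> 0"
proof (rule ccontr)
  define Z where "Z = (\<lambda>r. integral {s..r} z)"
  assume "\<not> integral {s..t} z \<ge> 0"
  then have neg: "Z t < 0" by (simp add: Z_def)
  have cont: "continuous_on {s..t} Z"
    unfolding Z_def by (rule indefinite_integral_continuous_1[OF int])
  define A where "A = {r \<in> {s..t}. Z r \<ge> 0}"
  have "closed A"
    using continuous_closed_preimage[OF cont closed_atLeastAtMost closed_atLeast[of 0]]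
    by (simp add: A_def Int_def vimage_def)
  moreover have "s \<in> A" "bdd_above A"
    using \<open>s \<le> t\<close> by (auto simp: A_def Z_def intro: bdd_aboveI[of _ t])
  ultimately have a: "Sup A \<in> A" by (intro closed_contains_Sup) auto
  define a where "a = Sup A"
  have a_props: "s \<le> a" "a \<le> t" "Z a \<ge> 0" using a by (auto simp: A_def a_def)
  have later: "Z r < 0" if "a < r" "r \<le> t" for r
    using cSup_upper[OF _ \<open>bdd_above A\<close>, of r] that a_props by (force simp: A_def a_def)
  have "integral {a..t} z \<ge> 0"
  proof (rule integral_nonneg_off_negligible)
    \<comment> \<open>The point \<open>a\<close> is discarded as well: \<open>Z\<close> is known to
      be negative only strictly to its right.\<close>
    show "negligible (insert a N)" using N by simp
    fix r assume r: "r \<in> {a..t} - insert a N"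
    then have "K * Z r \<le> 0"
      using later[of r] \<open>K \<ge> 0\<close> by (auto intro!: mult_nonneg_nonpos)
    then show "z r \<ge> 0" using super[of r] r a_props by (auto simp: Z_def)
  qed
  moreover have "Z a + integral {a..t} z = Z t"
    unfolding Z_def by (rule Henstock_Kurzweil_Integration.integral_combine) (use a_props int in auto)
  ultimately show False using neg a_props by linarith
qed

lemma integral_exp_decay:
  fixes D s t :: real
  assumes "D \<noteq> 0" and "s \<le> t"
  shows "((\<lambda>r. exp (- D * (r - s))) has_integral (1 - exp (- D * (t - s))) / D) {s..t}"
proof -
  have "((\<lambda>r. exp (- D * (r - s))) has_integral
      (- exp (- D * (t - s)) / D - (- exp (- D * (s - s)) / D))) {s..t}"
    using assms by (intro fundamental_theorem_of_calculus)
      (auto intro!: derivative_eq_intros simp: has_real_derivative_iff_has_vector_derivative[symmetric])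
  then show ?thesis by (simp add: diff_divide_distrib)
qed

theorem propositionA1:
  fixes y q :: "real \<Rightarrow> real" and K D' C' :: real and S :: "real set"
  assumes "y \<in> L1_loc"
    and "\<And>t. t \<ge> 0 \<Longrightarrow> q t \<ge> 0"
    and "K > 0" and "D' > 0" and "C' > 0" and "K \<noteq> D'"
    and "full_measure S" and "0 \<in> S"
    and "\<And>s t. s \<in> S \<Longrightarrow> t \<ge> s \<Longrightarrow> q t \<le> q s * exp (- D' * (t - s))"
    and "\<And>s t. s \<in> S \<Longrightarrow> t \<ge> s \<Longrightarrow>
           y t + K * (LINT \<tau>:{s..t}|lebesgue. y \<tau>)
             \<le> y s + C' * q s * (LINT \<tau>:{s..t}|lebesgue. exp (- D' * (\<tau> - s)))"
  shows "\<forall>s\<in>S. \<forall>t\<ge>s.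
           y t \<le> y s * exp (- K * (t - s))
             + C' * q s / (K - D') * (exp (- D' * (t - s)) - exp (- K * (t - s)))"
proof (intro ballI allI impI)
  fix s t assume sS: "s \<in> S" and st: "s \<le> t"
  have s0: "s \<ge> 0" using sS \<open>full_measure S\<close> by (auto simp: full_measure_def)
  define A where "A = C' * q s"
  define F where "F = (\<lambda>r. A * ((1 - exp (- D' * (r - s))) / D'))"
  define c where "c = y t + K * integral {s..t} y - F t"
  \<comment> \<open>Variation of constants: \<open>u\<close> solves
    \<open>u' = A * exp (- D' * (r - s)) - K * u\<close> with \<open>u s = c\<close>.\<close>
  define u where "u = (\<lambda>r. c * exp (- K * (r - s))
    + A / (K - D') * (exp (- D' * (r - s)) - exp (- K * (r - s))))"
  define N where "N = {0..} - S"
  have N: "negligible N"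
    using \<open>full_measure S\<close> by (simp add: full_measure_def N_def negligible_iff_null_sets)
  have y_set: "set_integrable lebesgue {a..b} y" if "0 \<le> a" "a \<le> b" for a b
  proof -
    \<comment> \<open>The right end is \<open>b + 1\<close> because \<open>L1_loc\<close> speaks
      only of \<open>T > 0\<close>, while \<open>b\<close> may be 0.\<close>
    have "set_integrable lebesgue {0..b + 1} y"
      using \<open>y \<in> L1_loc\<close> that by (auto simp: L1_loc_def)
    then show ?thesis by (rule set_integrable_subset) (use that in auto)
  qed
  have y_int: "y integrable_on {a..b}" if "0 \<le> a" "a \<le> b" for a b
    using y_set[OF that] by (rule set_lebesgue_integral_eq_integral)
  have key: "y b + K * integral {a..b} y \<le> y a + C' * q a * ((1 - exp (- D' * (b - a))) / D')"
    if "a \<in> S" "a \<le> b" for a b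
  proof -
    have "a \<ge> 0" using that \<open>full_measure S\<close> by (auto simp: full_measure_def)
    have "(\<lambda>\<tau>. exp (- D' * (\<tau> - a))) absolutely_integrable_on {a..b}"
      by (intro absolutely_integrable_continuous_real continuous_intros)
    then have "(LINT \<tau>:{a..b}|lebesgue. exp (- D' * (\<tau> - a))) = (1 - exp (- D' * (b - a))) / D'"
      using integral_exp_decay[of D' a b] \<open>D' > 0\<close> \<open>a \<le> b\<close>
      by (simp add: set_lebesgue_integral_eq_integral integral_unique)
    moreover have "(LINT \<tau>:{a..b}|lebesgue. y \<tau>) = integral {a..b} y"
      using y_set[OF \<open>a \<ge> 0\<close> \<open>a \<le> b\<close>] by (rule set_lebesgue_integral_eq_integral)
    ultimately show ?thesis using assms(10)[OF that] by simp
  qed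
  \<comment> \<open>The integral inequality is started at \<open>r\<close>. Decay of
    \<open>q\<close> from \<open>s\<close> to \<open>r\<close> bounds the forcing restarted at
    \<open>r\<close> by the remaining part \<open>F t - F r\<close> of the forcing started at
    \<open>s\<close>.\<close>
  have c_le: "c \<le> y r + K * integral {s..r} y - F r" if "r \<in> S" "s \<le> r" "r \<le> t" for r
  proof -
    have "q r * ((1 - exp (- D' * (t - r))) / D')
        \<le> q s * exp (- D' * (r - s)) * ((1 - exp (- D' * (t - r))) / D')"
      using assms(9)[OF sS \<open>s \<le> r\<close>] \<open>D' > 0\<close> \<open>r \<le> t\<close> by (intro mult_right_mono) auto
    then have "C' * (q r * ((1 - exp (- D' * (t - r))) / D'))
        \<le> C' * (q s * exp (- D' * (r - s)) * ((1 - exp (- D' * (t - r))) / D'))"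
      using \<open>C' > 0\<close> by (intro mult_left_mono) auto
    also have "\<dots> = A * ((exp (- D' * (r - s))
        - exp (- D' * (r - s)) * exp (- D' * (t - r))) / D')"
      by (simp add: A_def algebra_simps diff_divide_distrib)
    also have "exp (- D' * (r - s)) * exp (- D' * (t - r)) = exp (- D' * (t - s))"
      by (simp add: exp_add[symmetric] algebra_simps)
    also have "A * ((exp (- D' * (r - s)) - exp (- D' * (t - s))) / D') = F t - F r"
      by (simp add: F_def algebra_simps diff_divide_distrib)
    finally have "y t + K * integral {r..t} y \<le> y r + (F t - F r)"
      using key[OF \<open>r \<in> S\<close> \<open>r \<le> t\<close>] by (simp add: mult.assoc)
    moreover have "integral {s..r} y + integral {r..t} y = integral {s..t} y"
      by (rule Henstock_Kurzweil_Integration.integral_combine) (use that s0 st y_int in auto)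
    then have "K * integral {s..t} y = K * integral {s..r} y + K * integral {r..t} y"
      by (simp flip: distrib_left)
    ultimately show ?thesis by (simp add: c_def)
  qed
  have u_hi: "(u has_integral (c + F r - u r) / K) {s..r}" if "s \<le> r" for r
  proof -
    \<comment> \<open>The differential equation gives \<open>K * u = F' - u'\<close>, so
      \<open>(c + F - u) / K\<close> is an antiderivative of \<open>u\<close>; it vanishes at
      \<open>s\<close> since \<open>F s = 0\<close> and \<open>u s = c\<close>.\<close>
    have "(u has_integral ((c + F r - u r) / K - (c + F s - u s) / K)) {s..r}"
    proof (rule fundamental_theorem_of_calculus[OF that])
      fix x assume "x \<in> {s..r}"
      have "((\<lambda>x. (c + F x - u x) / K) has_real_derivative u x) (at x within {s..r})"
      proof -
        let ?E = "exp (- D' * (x - s))"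
        have "(F has_real_derivative A * ?E) (at x within {s..r})"
          unfolding F_def using \<open>D' > 0\<close> by (auto intro!: derivative_eq_intros)
        moreover have "(u has_real_derivative A * ?E - K * u x) (at x within {s..r})"
        proof -
          have "(u has_real_derivative c * (exp (- K * (x - s)) * - K)
              + A / (K - D') * (?E * - D' - exp (- K * (x - s)) * - K)) (at x within {s..r})"
            unfolding u_def using \<open>K \<noteq> D'\<close> by (auto intro!: derivative_eq_intros)
          \<comment> \<open>With the exponentials replaced by free variables this is a rational
            identity, resting on \<open>- D' = (K - D') - K\<close>.\<close>
          moreover have "c * (e * - K) + A / (K - D') * (E * - D' - e * - K)
              = A * E - K * (c * e + A / (K - D') * (E - e))" for e E
            using \<open>K \<noteq> D'\<close> by (simp add: divide_simps) (simp add: algebra_simps)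
          ultimately show ?thesis by (simp only: u_def)
        qed
        ultimately have "((\<lambda>x. (c + F x - u x) / K) has_real_derivative
            (0 + A * ?E - (A * ?E - K * u x)) / K) (at x within {s..r})"
          by (intro DERIV_cdivide DERIV_diff DERIV_add DERIV_const)
        then show ?thesis using \<open>K > 0\<close> by simp
      qed
      then show "((\<lambda>x. (c + F x - u x) / K) has_vector_derivative u x) (at x within {s..r})"
        by (simp add: has_real_derivative_iff_has_vector_derivative)
    qed
    then show ?thesis by (simp add: F_def u_def)
  qed
  define z where "z = (\<lambda>r. y r - u r)"
  have z_int: "z integrable_on {s..r}" and z_eq:
    "z r + K * integral {s..r} z = y r + K * integral {s..r} y - F r - c" if "s \<le> r" for r
  proof -
    have *: "(z has_integral (integral {s..r} y - (c + F r - u r) / K)) {s..r}"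
      unfolding z_def
      by (intro has_integral_diff u_hi[OF that] integrable_integral y_int[OF s0 that])
    show "z integrable_on {s..r}" using * by blast
    show "z r + K * integral {s..r} z = y r + K * integral {s..r} y - F r - c"
      unfolding integral_unique[OF *] using \<open>K > 0\<close> by (simp add: z_def field_simps)
  qed
  have "integral {s..t} z \<ge> 0"
  proof (rule primitive_nonneg_if_supersolution[OF _ st z_int[OF st] N])
    show "K \<ge> 0" using \<open>K > 0\<close> by simp
    fix r assume "r \<in> {s..t} - N"
    then show "z r + K * integral {s..r} z \<ge> 0"
      using z_eq[of r] c_le[of r] s0 by (auto simp: N_def)
  qed
  then have "K * integral {s..t} z \<ge> 0" using \<open>K > 0\<close> by simp
  \<comment> \<open>At \<open>r = t\<close> the right side of \<open>z_eq\<close> is 0, so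
    \<open>z t = - K * integral {s..t} z\<close>. This equality holds even when \<open>t\<close>
    lies outside \<open>S\<close>.\<close>
  then have "y t \<le> u t" using z_eq[OF st] by (simp add: c_def z_def)
  \<comment> \<open>At \<open>r = s\<close> both the integral and \<open>F\<close> vanish.\<close>
  moreover have "c \<le> y s" using c_le[OF sS _ st] by (simp add: F_def)
  then have "c * exp (- K * (t - s)) \<le> y s * exp (- K * (t - s))"
    by (intro mult_right_mono) auto
  ultimately show "y t \<le> y s * exp (- K * (t - s))
      + C' * q s / (K - D') * (exp (- D' * (t - s)) - exp (- K * (t - s)))"
    unfolding u_def A_def by linarith
qed

end
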